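(* Consider the inverse approximate optimization model with data $(U_i,Y_i)$, $i=1,\dots,n$, true parameters $(\epsilon_0,\theta_0)\in E\times\Theta$, solution sets $S(u,\epsilon,\theta)$ and noise set $W$, described in the context, with the identifiability condition stated there. Let $$(\breve\epsilon,\breve\theta)\in\arg\min\Big\{\tfrac1n\sum_{i=1}^nd^2(Y_i,S(U_i,\epsilon,\theta)\oplus W)+\lambda\cdot\epsilon\ \Big|\ \epsilon\in E,\theta\in\Theta\Big\},$$ where $\lambda\in\mathbb R_+$, and for $z\in\mathbb R_+$ (depending on $n$) let the ABP estimate $(\hat\epsilon,\hat\theta)$ be any element of $$\Big\{\epsilon\in E,\theta\in\Theta:\tfrac1n\sum_{i=1}^nd^2(Y_i,S(U_i,\epsilon,\theta)\oplus W)+\lambda\cdot\epsilon\le\tfrac1n\sum_{i=1}^nd^2(Y_i,S(U_i,\breve\epsilon,\breve\theta)\oplus W)+\lambda\cdot\breve\epsilon+z\Big\}.$$ Then the ABP estimator is strongly statistically consistent: $(\hat\epsilon,\hat\theta)\to(\epsilon_0,\theta_0)$ almost surely as $n\to\infty$, whenever $\lambda=1/n$ and $\lim_n(n\cdot z)=0$.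
   Context: $f(x,u,\theta)$ and $g(x,u,\theta)$ are continuous functions that are convex in $x$ for each fixed $u,\theta$, and for all $u,\theta$ there exists $x$ such that $g(x,u,\theta)<0$. Let $V(u,\theta)=\min_x\{f(x,u,\theta)\mid g(x,u,\theta)\le0\}$ and $S(u,\epsilon,\theta)=\{x:f(x,u,\theta)\le V(u,\theta)+\epsilon,\ g(x,u,\theta)\le0\}$. Data: $(U_i,Y_i)\in D\times\mathbb R^p$, where the $U_i$ are i.i.d. random vectors distributed on $D\subseteq\mathbb R^d$; $Y_i=X_i+W_i$, where the $X_i$ are i.i.d. random vectors distributed on $S(U_i,\epsilon_0,\theta_0)$, with constants $\epsilon_0\in\mathbb R_+$ and $\theta_0\in\mathbb R^p$; and the $W_i$ are i.i.d. random vectors with $\mathbb E(W_i)=0$ distributed on a known convex set $W$ with finite support (i.e., bounded). The densities satisfy $f_W(u)>0$ for $u\in\mathrm{int}(W)$ and $f_X(u\mid U_i)>0$ for $u\in\mathrm{int}(S(U_i,\epsilon_0,\theta_0))$. $E\subseteq\mathbb R_+$ is a known closed set with $\epsilon_0\in E$, and $\Theta\subseteq\mathbb R^p$ is a known compact set with $\theta_0\in\Theta$. Identifiability condition: $\mathbb E\big(d^2(Y_i,S(U_i,\epsilon,\theta)\oplus W)\big)>0$ for all $\epsilon\in[0,\epsilon_0)$ and $\theta\in\Theta\setminus\{\theta_0\}$. Notation: $d^2(x,C)=\inf_{y\in C}\|x-y\|^2$; $C\oplus D=\{c+d:c\in C,d\in D\}$.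
   Formalization: The identifiability condition is strengthened: positive expected loss is required for every (ε,θ) in [0,ε0]×Θ other than (ε0,θ0), since the stated condition (only ε<ε0 together with θ≠θ0) admits solution sets independent of θ, for which consistency fails. *)

theory Defs
  imports "HOL-Probability.Probability" "HOL-Library.Set_Algebras"
begin

(* Only meaningful for nonempty C: the infimum of the empty set of reals is unspecified. *)
definition dist_sq :: "real ^ 'p \<Rightarrow> (real ^ 'p) set \<Rightarrow> real" where
  "dist_sq x C = (INF y\<in>C. (norm (x - y))\<^sup>2)"

type_synonym ('p, 'd) param_fun = "real ^ 'p \<Rightarrow> real ^ 'd \<Rightarrow> real ^ 'p \<Rightarrow> real"

(* This is the minimum only if the minimum is attained, which has to be assumed separately. *)
definition opt_val :: "('p, 'd) param_fun \<Rightarrow> ('p, 'd) param_fun \<Rightarrow> real ^ 'd \<Rightarrow> real ^ 'p \<Rightarrow> real" where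
  "opt_val f g u \<theta> = (INF x\<in>{x. g x u \<theta> \<le> 0}. f x u \<theta>)"

definition sol_set ::
  "('p, 'd) param_fun \<Rightarrow> ('p, 'd) param_fun \<Rightarrow> real ^ 'd \<Rightarrow> real \<Rightarrow> real ^ 'p \<Rightarrow> (real ^ 'p) set" where
  "sol_set f g u \<epsilon> \<theta> = {x. f x u \<theta> \<le> opt_val f g u \<theta> + \<epsilon> \<and> g x u \<theta> \<le> 0}"

(* The + between sets is the Minkowski sum of HOL-Library.Set_Algebras.  Samples are numbered
   0, ..., n - 1. *)
definition abp_obj ::
  "('p, 'd) param_fun \<Rightarrow> ('p, 'd) param_fun \<Rightarrow> (real ^ 'p) set \<Rightarrow> nat \<Rightarrow> real
    \<Rightarrow> (nat \<Rightarrow> real ^ 'd) \<Rightarrow> (nat \<Rightarrow> real ^ 'p) \<Rightarrow> real \<times> (real ^ 'p) \<Rightarrow> real" where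
  "abp_obj f g W n l u y = (\<lambda>(\<epsilon>, \<theta>).
     1 / real n * (\<Sum>i<n. dist_sq (y i) (sol_set f g (u i) \<epsilon> \<theta> + W)) + l * \<epsilon>)"

definition iid :: "'a measure \<Rightarrow> 'b measure \<Rightarrow> (nat \<Rightarrow> 'a \<Rightarrow> 'b) \<Rightarrow> bool" where
  "iid M N Z \<longleftrightarrow> prob_space.indep_vars M (\<lambda>_. N) Z UNIV \<and>
     (\<forall>i. distr M N (Z i) = distr M N (Z 0))"

(* The joint law of (U, X) has density h with respect to (law of U) x Lebesgue measure,
   i.e. x \<mapsto> h (u, x) is a conditional Lebesgue density of X given U = u. *)
definition has_cond_density ::
  "'a measure \<Rightarrow> ('a \<Rightarrow> real ^ 'd) \<Rightarrow> ('a \<Rightarrow> real ^ 'p) \<Rightarrow> ((real ^ 'd) \<times> (real ^ 'p) \<Rightarrow> ennreal) \<Rightarrow> bool" where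
  "has_cond_density M U X h \<longleftrightarrow>
     distributed M (distr M borel U \<Otimes>\<^sub>M lborel) (\<lambda>\<omega>. (U \<omega>, X \<omega>)) h"

(* Every parameter pair in [0, \<epsilon>0] x \<Theta> other than the true one has positive expected loss.
   The connective has to be a disjunction: if only pairs with both \<epsilon> < \<epsilon>0 and \<theta> \<noteq> \<theta>0 were
   covered, solution sets that do not depend on \<theta> would be admitted, and then no estimator can
   recover \<theta>0.  The expectation is taken in [0, \<infinity>], so it need not be finite. *)
definition identifiable ::
  "'a measure \<Rightarrow> ('p, 'd) param_fun \<Rightarrow> ('p, 'd) param_fun \<Rightarrow> (real ^ 'p) set
    \<Rightarrow> (nat \<Rightarrow> 'a \<Rightarrow> real ^ 'd) \<Rightarrow> (nat \<Rightarrow> 'a \<Rightarrow> real ^ 'p) \<Rightarrow> (real ^ 'p) set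
    \<Rightarrow> real \<Rightarrow> real ^ 'p \<Rightarrow> bool" where
  "identifiable M f g W U Y \<Theta> \<epsilon>0 \<theta>0 \<longleftrightarrow>
     (\<forall>i. \<forall>\<epsilon>\<in>{0..\<epsilon>0}. \<forall>\<theta>\<in>\<Theta>. \<epsilon> < \<epsilon>0 \<or> \<theta> \<noteq> \<theta>0 \<longrightarrow>
        (\<integral>\<^sup>+ \<omega>. ennreal (dist_sq (Y i \<omega>) (sol_set f g (U i \<omega>) \<epsilon> \<theta> + W)) \<partial>M) > 0)"

end

theory Submission
  imports Defs
begin

text \<open>
  The true parameters have empirical loss 0, so comparing objectives and multiplying by \<open>n\<close> shows
  that the unnormalised loss of the estimate plus its \<open>\<epsilon>\<close>-component is at most \<open>\<epsilon>0 + n z\<close>. Hence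
  \<open>\<epsilon>\<close> is at most \<open>\<epsilon>0\<close> in the limit, and the unnormalised loss stays bounded. By Slater's condition
  the optimal value is upper semicontinuous, so the loss is bounded away from 0 near every point
  where it is positive. With identifiability, every wrong parameter pair has a neighbourhood on
  which one and the same event of positive probability forces the loss to exceed a fixed positive
  constant. Independence makes this event recur infinitely often, so the unnormalised loss diverges
  uniformly on the neighbourhood and the estimate eventually leaves it. Countably many such
  neighbourhoods suffice, and compactness of \<open>\<Theta>\<close> concludes. No law of large numbers is needed.
\<close>

section \<open>Squared distance to a set and Minkowski sums\<close>

lemma dist_sq_nonneg:
  assumes "C \<noteq> {}"
  shows "0 \<le> dist_sq x C"
  unfolding dist_sq_def using assms by (intro cINF_greatest) auto

lemma dist_sq_le:
  assumes "y \<in> C"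
  shows "dist_sq x C \<le> (norm (x - y))\<^sup>2"
  unfolding dist_sq_def using assms by (intro cINF_lower bdd_belowI2[where m = 0]) auto

lemma dist_sq_eq_0:
  assumes "x \<in> C"
  shows "dist_sq x C = 0"
  using dist_sq_le[OF assms, of x] dist_sq_nonneg[of C x] assms by auto

lemma dist_sq_less_obtain:
  assumes "C \<noteq> {}" "dist_sq x C < c"
  obtains y where "y \<in> C" "(norm (x - y))\<^sup>2 < c"
proof -
  have "\<exists>v\<in>(\<lambda>y. (norm (x - y))\<^sup>2) ` C. v < c"
    using assms by (intro cInf_lessD) (auto simp: dist_sq_def)
  then show thesis using that by blast
qed

lemma set_plus_nonempty:
  fixes A B :: "'a::plus set"
  assumes "A \<noteq> {}" "B \<noteq> {}"
  shows "A + B \<noteq> {}"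
  using assms set_plus_intro by blast

section \<open>Parametric convex programs: optimal values and solution sets\<close>

locale convex_program =
  fixes f g :: "('p::finite, 'd::finite) param_fun"
    and D :: "(real ^ 'd) set" and \<Theta> :: "(real ^ 'p) set"
  assumes cont_f: "continuous_on (UNIV \<times> D \<times> \<Theta>) (\<lambda>(x, u, \<theta>). f x u \<theta>)"
    and cont_g: "continuous_on (UNIV \<times> D \<times> \<Theta>) (\<lambda>(x, u, \<theta>). g x u \<theta>)"
    and convex_f: "\<And>u \<theta>. u \<in> D \<Longrightarrow> \<theta> \<in> \<Theta> \<Longrightarrow> convex_on UNIV (\<lambda>x. f x u \<theta>)"
    and convex_g: "\<And>u \<theta>. u \<in> D \<Longrightarrow> \<theta> \<in> \<Theta> \<Longrightarrow> convex_on UNIV (\<lambda>x. g x u \<theta>)"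
    and slater: "\<And>u \<theta>. u \<in> D \<Longrightarrow> \<theta> \<in> \<Theta> \<Longrightarrow> \<exists>x. g x u \<theta> < 0"
    and min_attained: "\<And>u \<theta>. u \<in> D \<Longrightarrow> \<theta> \<in> \<Theta> \<Longrightarrow>
           \<exists>x. is_arg_min (\<lambda>x. f x u \<theta>) (\<lambda>x. g x u \<theta> \<le> 0) x"
begin

text \<open>Attainment turns the infimum in \<open>opt_val\<close> into a genuine minimum. For an
  objective unbounded below on the feasible set, the real infimum would be unspecified.\<close>

lemma opt_val_attained:
  assumes "u \<in> D" "\<theta> \<in> \<Theta>"
  obtains x where "g x u \<theta> \<le> 0" "f x u \<theta> = opt_val f g u \<theta>"
    "\<And>y. g y u \<theta> \<le> 0 \<Longrightarrow> f x u \<theta> \<le> f y u \<theta>"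
proof -
  obtain x where x: "g x u \<theta> \<le> 0" "\<And>y. g y u \<theta> \<le> 0 \<Longrightarrow> f x u \<theta> \<le> f y u \<theta>"
    using min_attained[OF assms] by (auto simp: is_arg_min_linorder)
  have "opt_val f g u \<theta> = f x u \<theta>"
    unfolding opt_val_def using x by (intro cInf_eq_minimum) auto
  with x that show thesis by metis
qed

lemma opt_val_le:
  assumes "u \<in> D" "\<theta> \<in> \<Theta>" "g x u \<theta> \<le> 0"
  shows "opt_val f g u \<theta> \<le> f x u \<theta>"
  using opt_val_attained[OF assms(1,2)] assms(3) by metis

lemma sol_set_nonempty:
  assumes "u \<in> D" "\<theta> \<in> \<Theta>" "0 \<le> \<epsilon>"
  shows "sol_set f g u \<epsilon> \<theta> \<noteq> {}"
  using opt_val_attained[OF assms(1,2)] assms(3) unfolding sol_set_def by fastforce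

section \<open>Stability of optimal values and solution sets under parameter changes\<close>

lemma tendsto_program_fun:
  assumes "continuous_on (UNIV \<times> D \<times> \<Theta>) (\<lambda>(x, u, \<theta>). h x u \<theta>)"
    and "(x \<longlongrightarrow> x0) F" "(u \<longlongrightarrow> u0) F" "(\<theta> \<longlongrightarrow> \<theta>0) F"
    and "u0 \<in> D" "\<theta>0 \<in> \<Theta>" "\<And>k. u k \<in> D" "\<And>k. \<theta> k \<in> \<Theta>"
  shows "((\<lambda>k. h (x k) (u k) (\<theta> k)) \<longlongrightarrow> h x0 u0 \<theta>0) F"
proof -
  have "((\<lambda>k. (x k, u k, \<theta> k)) \<longlongrightarrow> (x0, u0, \<theta>0)) F"
    by (intro tendsto_Pair assms)
  from continuous_on_tendsto_compose[OF assms(1) this] assms show ?thesis by simp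
qed

text \<open>A feasible point moved slightly towards a Slater point is strictly feasible, so it stays
  feasible for all nearby parameters.\<close>

lemma opt_val_upper_semicontinuous:
  assumes u: "(u \<longlongrightarrow> u0) F" and \<theta>: "(\<theta> \<longlongrightarrow> \<theta>0) F"
    and in0: "u0 \<in> D" "\<theta>0 \<in> \<Theta>" and mem: "\<And>k. u k \<in> D" "\<And>k. \<theta> k \<in> \<Theta>"
    and c: "opt_val f g u0 \<theta>0 < c"
  shows "eventually (\<lambda>k. opt_val f g (u k) (\<theta> k) < c) F"
proof -
  obtain x where x: "g x u0 \<theta>0 \<le> 0" "f x u0 \<theta>0 = opt_val f g u0 \<theta>0"
    using opt_val_attained[OF in0] by metis
  obtain s where s: "g s u0 \<theta>0 < 0" using slater[OF in0] by blast
  \<comment> \<open>The weight \<open>t\<close> of the Slater point must be positive for strict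
    feasibility. By convexity this combination bounds the objective at the mixed point, and it tends
    to the optimal value, which is below \<open>c\<close>, so a small \<open>t\<close>
    works.\<close>
  have "((\<lambda>t. (1 - t) * f x u0 \<theta>0 + t * f s u0 \<theta>0) \<longlongrightarrow> (1 - 0) * f x u0 \<theta>0 + 0 * f s u0 \<theta>0) (at_right 0)"
    by (intro tendsto_intros)
  then have "eventually (\<lambda>t. (1 - t) * f x u0 \<theta>0 + t * f s u0 \<theta>0 < c) (at_right 0)"
    using c x by (intro order_tendstoD(2)) auto
  moreover have "eventually (\<lambda>t::real. 0 < t) (at_right 0)" "eventually (\<lambda>t::real. t < 1) (at_right 0)"
    by (auto simp: eventually_at_right_less eventually_at_right_real intro: order_tendstoD(2)[OF tendsto_ident_at])
  ultimately have "eventually (\<lambda>t. (1 - t) * f x u0 \<theta>0 + t * f s u0 \<theta>0 < c \<and> 0 < t \<and> t < 1) (at_right 0)"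
    by eventually_elim auto
  then obtain t where t: "(1 - t) * f x u0 \<theta>0 + t * f s u0 \<theta>0 < c" "0 < t" "t < 1"
    using eventually_happens'[OF trivial_limit_at_right_real] by blast
  define y where "y = (1 - t) *\<^sub>R x + t *\<^sub>R s"
  have fy: "f y u0 \<theta>0 < c"
    using convex_onD[OF convex_f[OF in0], of t x s] t unfolding y_def by auto
  have "(1 - t) * g x u0 \<theta>0 \<le> 0" "t * g s u0 \<theta>0 < 0"
    using t x s by (auto simp: mult_nonneg_nonpos mult_pos_neg)
  then have gy: "g y u0 \<theta>0 < 0"
    using convex_onD[OF convex_g[OF in0], of t x s] t unfolding y_def by auto
  have "eventually (\<lambda>k. f y (u k) (\<theta> k) < c) F"
    using tendsto_program_fun[OF cont_f tendsto_const u \<theta> in0 mem] fy by (rule order_tendstoD(2))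
  moreover have "eventually (\<lambda>k. g y (u k) (\<theta> k) < 0) F"
    using tendsto_program_fun[OF cont_g tendsto_const u \<theta> in0 mem] gy by (rule order_tendstoD(2))
  ultimately show ?thesis
  proof eventually_elim
    case (elim k)
    with opt_val_le[OF mem[of k], of y] show ?case by simp
  qed
qed

text \<open>The constraint passes to the limit by continuity. For the inequality
  \<open>f \<le> opt_val + \<epsilon>\<close> the right side must not jump up nearby, which is
  exactly upper semicontinuity of the value.\<close>

lemma sol_set_outer_semicontinuous:
  assumes "x \<longlonglongrightarrow> x0" "u \<longlonglongrightarrow> u0" "\<epsilon> \<longlonglongrightarrow> \<epsilon>0" "\<theta> \<longlonglongrightarrow> \<theta>0"
    and "u0 \<in> D" "\<theta>0 \<in> \<Theta>" "\<And>k. u k \<in> D" "\<And>k. \<theta> k \<in> \<Theta>"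
    and sol: "\<And>k. x k \<in> sol_set f g (u k) (\<epsilon> k) (\<theta> k)"
  shows "x0 \<in> sol_set f g u0 \<epsilon>0 \<theta>0"
proof -
  have "(\<lambda>k. g (x k) (u k) (\<theta> k)) \<longlonglongrightarrow> g x0 u0 \<theta>0"
    by (rule tendsto_program_fun[OF cont_g assms(1,2,4-8)])
  then have "g x0 u0 \<theta>0 \<le> 0"
    by (rule LIMSEQ_le_const2) (use sol in \<open>auto simp: sol_set_def\<close>)
  moreover have "f x0 u0 \<theta>0 \<le> opt_val f g u0 \<theta>0 + \<epsilon>0"
  \<comment> \<open>Semicontinuity bounds the nearby values only up to a slack \<open>e\<close>,
    which is removed at the end.\<close>
  proof (rule field_le_epsilon)
    fix e :: real assume "0 < e"
    then have "eventually (\<lambda>k. opt_val f g (u k) (\<theta> k) < opt_val f g u0 \<theta>0 + e) sequentially"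
      by (intro opt_val_upper_semicontinuous[of u u0 _ \<theta> \<theta>0] assms) auto
    then have "eventually (\<lambda>k. f (x k) (u k) (\<theta> k) \<le> opt_val f g u0 \<theta>0 + e + \<epsilon> k) sequentially"
    proof eventually_elim
      case (elim k)
      then show ?case using sol[of k] by (auto simp: sol_set_def)
    qed
    with tendsto_program_fun[OF cont_f assms(1,2,4-8)]
      tendsto_add[OF tendsto_const[of "opt_val f g u0 \<theta>0 + e"] assms(3)]
    have "f x0 u0 \<theta>0 \<le> opt_val f g u0 \<theta>0 + e + \<epsilon>0"
      by (intro tendsto_le[OF sequentially_bot])
    then show "f x0 u0 \<theta>0 \<le> opt_val f g u0 \<theta>0 + \<epsilon>0 + e" by simp
  qed
  ultimately show ?thesis by (simp add: sol_set_def)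
qed

section \<open>Lower bounds on the loss near points where it is positive\<close>

text \<open>Otherwise there are nearby data and parameters with loss tending to 0. Almost optimal
  decompositions into solution and noise then converge along a subsequence and place
  \<open>y0\<close> in the solution set plus the closure of \<open>W\<close>, which forces loss 0. A
  single \<delta> serves as radius and as lower bound.\<close>

lemma loss_locally_bounded_below:
  assumes W: "bounded W" "W \<noteq> {}" and in0: "u0 \<in> D" "\<theta>0 \<in> \<Theta>"
    and pos: "0 < dist_sq y0 (sol_set f g u0 \<epsilon>0 \<theta>0 + W)"
  shows "\<exists>\<delta>>0. \<forall>y u \<epsilon> \<theta>. dist y y0 < \<delta> \<longrightarrow> dist u u0 < \<delta> \<longrightarrow> dist \<epsilon> \<epsilon>0 < \<delta> \<longrightarrow> dist \<theta> \<theta>0 < \<delta> \<longrightarrow>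
           u \<in> D \<longrightarrow> \<theta> \<in> \<Theta> \<longrightarrow> 0 \<le> \<epsilon> \<longrightarrow> \<delta> \<le> dist_sq y (sol_set f g u \<epsilon> \<theta> + W)"
proof (rule ccontr)
  let ?d = "\<lambda>k::nat. 1 / real (Suc k)"
  assume neg: "\<not> ?thesis"
  have "\<exists>y u \<epsilon> \<theta>. dist y y0 < ?d k \<and> dist u u0 < ?d k \<and> dist \<epsilon> \<epsilon>0 < ?d k \<and> dist \<theta> \<theta>0 < ?d k \<and>
      u \<in> D \<and> \<theta> \<in> \<Theta> \<and> 0 \<le> \<epsilon> \<and> dist_sq y (sol_set f g u \<epsilon> \<theta> + W) < ?d k" for k
  proof -
    have "0 < ?d k" by simp
    with neg show ?thesis by (meson not_le)
  qed
  then obtain y u \<epsilon> \<theta> where near: "\<And>k. dist (y k) y0 < ?d k" "\<And>k. dist (u k) u0 < ?d k"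
      "\<And>k. dist (\<epsilon> k) \<epsilon>0 < ?d k" "\<And>k. dist (\<theta> k) \<theta>0 < ?d k"
    and mem: "\<And>k. u k \<in> D" "\<And>k. \<theta> k \<in> \<Theta>" "\<And>k. 0 \<le> \<epsilon> k"
    and small: "\<And>k. dist_sq (y k) (sol_set f g (u k) (\<epsilon> k) (\<theta> k) + W) < ?d k"
    by metis
  have d0: "?d \<longlonglongrightarrow> 0" by (rule LIMSEQ_Suc[OF lim_1_over_n])
  have lim_of_near: "v \<longlonglongrightarrow> v0" if "\<And>k. dist (v k) v0 < ?d k" for v :: "nat \<Rightarrow> 'z::metric_space" and v0
    using that by (intro metric_tendsto_imp_tendsto[OF d0, of _ v0]) (auto intro!: always_eventually less_imp_le)
  note lims = near[THEN lim_of_near]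
  have "\<exists>s w. s \<in> sol_set f g (u k) (\<epsilon> k) (\<theta> k) \<and> w \<in> W \<and> (norm (y k - (s + w)))\<^sup>2 < ?d k" for k
  proof -
    have "sol_set f g (u k) (\<epsilon> k) (\<theta> k) + W \<noteq> {}"
      by (intro set_plus_nonempty sol_set_nonempty mem W)
    from dist_sq_less_obtain[OF this small] show ?thesis
      by (metis set_plus_elim)
  qed
  then obtain s w where s: "\<And>k. s k \<in> sol_set f g (u k) (\<epsilon> k) (\<theta> k)" and w: "\<And>k. w k \<in> W"
    and sw: "\<And>k. (norm (y k - (s k + w k)))\<^sup>2 < ?d k"
    by metis
  \<comment> \<open>\<open>W\<close> is bounded but possibly not closed, so the noise parts have a
    limit only in its closure.\<close>
  have "compact (closure W)" using W by (simp add: compact_closure)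
  moreover have "\<forall>k. w k \<in> closure W" using w closure_subset by blast
  ultimately obtain w0 r where w0: "w0 \<in> closure W" and r: "strict_mono r" and wr: "(w \<circ> r) \<longlonglongrightarrow> w0"
    unfolding compact_def by metis
  have sub: "(\<lambda>k. v (r k)) \<longlonglongrightarrow> v0" if "v \<longlonglongrightarrow> v0" for v :: "nat \<Rightarrow> 'z::metric_space" and v0
    using LIMSEQ_subseq_LIMSEQ[OF that r] by (simp add: o_def)
  have "(\<lambda>k. (norm (y k - (s k + w k)))\<^sup>2) \<longlonglongrightarrow> 0"
    by (rule tendsto_sandwich[OF _ _ tendsto_const d0]) (use sw in \<open>auto intro!: always_eventually less_imp_le\<close>)
  then have "(\<lambda>k. sqrt ((norm (y k - (s k + w k)))\<^sup>2)) \<longlonglongrightarrow> sqrt 0" by (rule tendsto_real_sqrt)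
  then have "(\<lambda>k. y k - (s k + w k)) \<longlonglongrightarrow> 0" by (simp add: tendsto_norm_zero_iff)
  \<comment> \<open>The solution sets may be unbounded. Their points \<open>s (r k)\<close> converge
    because they equal data minus residual minus noise, and these three converge.\<close>
  then have "(\<lambda>k. y (r k) - (y (r k) - (s (r k) + w (r k))) - w (r k)) \<longlonglongrightarrow> y0 - 0 - w0"
    using sub[of "\<lambda>k. y k - (s k + w k)" 0] sub[OF lims(1)] wr by (intro tendsto_diff) (auto simp: o_def)
  then have "(\<lambda>k. s (r k)) \<longlonglongrightarrow> y0 - w0" by simp
  then have s0: "y0 - w0 \<in> sol_set f g u0 \<epsilon>0 \<theta>0"
    by (rule sol_set_outer_semicontinuous[OF _ lims(2-4)[THEN sub] in0 mem(1,2) s])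
  \<comment> \<open>The limit \<open>w0\<close> may lie outside \<open>W\<close>, so a point of
    \<open>W\<close> within \<open>e\<close> of it is used instead; \<open>e\<close> is chosen so
    that its square is half the allegedly positive loss.\<close>
  define e where "e = sqrt (dist_sq y0 (sol_set f g u0 \<epsilon>0 \<theta>0 + W) / 2)"
  then have e: "0 < e" "e\<^sup>2 < dist_sq y0 (sol_set f g u0 \<epsilon>0 \<theta>0 + W)"
    using pos by simp_all
  obtain v where v: "v \<in> W" "dist v w0 < e"
    using w0 e by (meson closure_approachable)
  have "dist_sq y0 (sol_set f g u0 \<epsilon>0 \<theta>0 + W) \<le> (norm (y0 - (y0 - w0 + v)))\<^sup>2"
    using s0 v by (intro dist_sq_le set_plus_intro)
  also have "\<dots> \<le> e\<^sup>2" using v by (intro power_mono) (auto simp: dist_norm norm_minus_commute)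
  finally show False using e by simp
qed

text \<open>Covering the points of positive loss by countably many open sets avoids any
  measurability assumption on the loss itself.\<close>

lemma positive_loss_neighbourhood:
  fixes U :: "'a \<Rightarrow> real ^ 'd" and Y :: "'a \<Rightarrow> real ^ 'p"
  assumes "prob_space M"
    and rv [measurable]: "U \<in> borel_measurable M" "Y \<in> borel_measurable M"
    and U: "AE \<omega> in M. U \<omega> \<in> D"
    and W: "bounded W" "W \<noteq> {}" and \<theta>0: "\<theta>0 \<in> \<Theta>"
    and pos: "0 < (\<integral>\<^sup>+ \<omega>. ennreal (dist_sq (Y \<omega>) (sol_set f g (U \<omega>) \<epsilon>0 \<theta>0 + W)) \<partial>M)"
  obtains G \<delta> where "open G" "0 < \<delta>" "0 < measure M {\<omega> \<in> space M. (U \<omega>, Y \<omega>) \<in> G}"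
    "\<And>u y \<epsilon> \<theta>. (u, y) \<in> G \<Longrightarrow> u \<in> D \<Longrightarrow> (\<epsilon>, \<theta>) \<in> ball (\<epsilon>0, \<theta>0) \<delta> \<Longrightarrow> 0 \<le> \<epsilon> \<Longrightarrow> \<theta> \<in> \<Theta> \<Longrightarrow>
       \<delta> \<le> dist_sq y (sol_set f g u \<epsilon> \<theta> + W)"
proof -
  interpret prob_space M by fact
  let ?d = "\<lambda>k::nat. 1 / real (Suc k)"
  let ?P = "\<lambda>k A. \<forall>u y \<epsilon> \<theta>. (u, y) \<in> A \<longrightarrow> u \<in> D \<longrightarrow> (\<epsilon>, \<theta>) \<in> ball (\<epsilon>0, \<theta>0) (?d k) \<longrightarrow> 0 \<le> \<epsilon> \<longrightarrow> \<theta> \<in> \<Theta> \<longrightarrow>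
       ?d k \<le> dist_sq y (sol_set f g u \<epsilon> \<theta> + W)"
  \<comment> \<open>\<open>?P k\<close> passes to arbitrary unions, so \<open>G k\<close> is the
    largest open set on which it holds. Again one number \<open>?d k\<close> is both radius and
    bound.\<close>
  define G where "G k = \<Union>{A. open A \<and> ?P k A}" for k
  have G_open: "open (G k)" for k unfolding G_def by auto
  have G_bound: "?P k (G k)" for k unfolding G_def by blast
  have cover: "\<exists>k. (u, y) \<in> G k" if "u \<in> D" "0 < dist_sq y (sol_set f g u \<epsilon>0 \<theta>0 + W)" for u y
  proof -
    from loss_locally_bounded_below[OF W that(1) \<theta>0 that(2)]
    obtain \<delta> where \<delta>: "0 < \<delta>" and low: "\<And>y' u' \<epsilon> \<theta>. dist y' y < \<delta> \<Longrightarrow> dist u' u < \<delta> \<Longrightarrow> dist \<epsilon> \<epsilon>0 < \<delta> \<Longrightarrow>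
        dist \<theta> \<theta>0 < \<delta> \<Longrightarrow> u' \<in> D \<Longrightarrow> \<theta> \<in> \<Theta> \<Longrightarrow> 0 \<le> \<epsilon> \<Longrightarrow> \<delta> \<le> dist_sq y' (sol_set f g u' \<epsilon> \<theta> + W)"
      by metis
    obtain k where k: "?d k < \<delta>" using nat_approx_posE[OF \<delta>] by blast
    have "?P k (ball (u, y) \<delta>)"
    proof (intro allI impI)
      fix u' y' \<epsilon> \<theta>
      assume *: "(u', y') \<in> ball (u, y) \<delta>" "u' \<in> D" "(\<epsilon>, \<theta>) \<in> ball (\<epsilon>0, \<theta>0) (?d k)" "0 \<le> \<epsilon>" "\<theta> \<in> \<Theta>"
      have "dist u' u < \<delta>" "dist y' y < \<delta>"
        using *(1) dist_fst_le[of "(u', y')" "(u, y)"] dist_snd_le[of "(u', y')" "(u, y)"]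
        by (auto simp: dist_commute)
      moreover have "dist \<epsilon> \<epsilon>0 < \<delta>" "dist \<theta> \<theta>0 < \<delta>"
        using *(3) k dist_fst_le[of "(\<epsilon>, \<theta>)" "(\<epsilon>0, \<theta>0)"] dist_snd_le[of "(\<epsilon>, \<theta>)" "(\<epsilon>0, \<theta>0)"]
        unfolding mem_ball by (simp_all add: dist_commute)
      ultimately show "?d k \<le> dist_sq y' (sol_set f g u' \<epsilon> \<theta> + W)"
        using low[of y' u' \<epsilon> \<theta>] * k by linarith
    qed
    then have "ball (u, y) \<delta> \<subseteq> G k" unfolding G_def by blast
    moreover have "(u, y) \<in> ball (u, y) \<delta>" using \<delta> by simp
    ultimately show ?thesis by blast
  qed
  have meas: "{\<omega> \<in> space M. (U \<omega>, Y \<omega>) \<in> G k} \<in> events" for k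
  proof -
    have eq: "{\<omega> \<in> space M. (U \<omega>, Y \<omega>) \<in> G k} = (\<lambda>\<omega>. (U \<omega>, Y \<omega>)) -` G k \<inter> space M" by blast
    show ?thesis
      unfolding eq by (rule measurable_sets[OF borel_measurable_Pair[OF rv] borel_open[OF G_open]])
  qed
  \<comment> \<open>If every \<open>G k\<close> were null, their countable union would be null too;
    it covers all points of positive loss, so the expected loss would vanish.\<close>
  have "\<exists>k. 0 < prob {\<omega> \<in> space M. (U \<omega>, Y \<omega>) \<in> G k}"
  proof (rule ccontr)
    assume "\<not> ?thesis"
    then have "prob {\<omega> \<in> space M. (U \<omega>, Y \<omega>) \<in> G k} = 0" for k
      by (simp add: not_less measure_le_0_iff)
    then have "AE \<omega> in M. \<omega> \<notin> {\<omega> \<in> space M. (U \<omega>, Y \<omega>) \<in> G k}" for k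
      using prob_eq_0[OF meas] by blast
    then have "AE \<omega> in M. \<forall>k. \<omega> \<notin> {\<omega> \<in> space M. (U \<omega>, Y \<omega>) \<in> G k}"
      by (simp add: AE_all_countable)
    then have "AE \<omega> in M. ennreal (dist_sq (Y \<omega>) (sol_set f g (U \<omega>) \<epsilon>0 \<theta>0 + W)) = 0"
      using U AE_space
    proof eventually_elim
      case (elim \<omega>)
      \<comment> \<open>This suffices because \<open>ennreal\<close> sends every nonpositive real to
        0.\<close>
      then have "\<not> 0 < dist_sq (Y \<omega>) (sol_set f g (U \<omega>) \<epsilon>0 \<theta>0 + W)"
        using cover[of "U \<omega>" "Y \<omega>"] by blast
      then show ?case by (simp add: ennreal_neg)
    qed
    from nn_integral_cong_AE[OF this] pos show False by simp
  qed
  then obtain k where "0 < prob {\<omega> \<in> space M. (U \<omega>, Y \<omega>) \<in> G k}" by blast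
  with that[of "G k" "?d k"] G_open[of k] G_bound[of k] show thesis by simp
qed

end

section \<open>Recurrence of independent events, and convergence criteria\<close>

text \<open>The second Borel-Cantelli lemma for events of equal probability: avoiding
  \<open>A\<close> at \<open>k\<close> given indices has probability \<open>(1 - p) ^ k\<close>, so
  avoiding it from some index on has probability 0.\<close>

lemma (in prob_space) indep_vars_infinitely_often:
  assumes indep: "indep_vars (\<lambda>_. N) Z UNIV" and A: "A \<in> sets N"
    and prob: "\<And>i::nat. prob (Z i -` A \<inter> space M) = p" and p: "0 < p"
  shows "AE \<omega> in M. infinite {i. Z i \<omega> \<in> A}"
proof -
  let ?B = "space N - A"
  have rv: "Z i \<in> measurable M N" for i
    using indep unfolding indep_vars_def by auto
  have evB: "Z i -` ?B \<inter> space M \<in> events" for i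
    by (rule measurable_sets[OF rv]) (use A in auto)
  have "Z i -` ?B \<inter> space M = space M - (Z i -` A \<inter> space M)" for i
    using measurable_space[OF rv] by auto
  then have probB: "prob (Z i -` ?B \<inter> space M) = 1 - p" for i
    using prob_compl[OF measurable_sets[OF rv A]] prob by simp
  then have p1: "0 \<le> 1 - p" by (metis measure_nonneg)
  have "AE \<omega> in M. \<not> (\<forall>i\<ge>n. Z i \<omega> \<in> ?B)" for n
  proof -
    let ?C = "\<Inter>i\<in>{n..}. Z i -` ?B \<inter> space M"
    have ev: "?C \<in> events" by (intro sets.countable_INT') (use evB in auto)
    \<comment> \<open>Only \<open>k\<close> of the infinitely many factors are kept. An empty
      intersection would be \<open>UNIV\<close> rather than \<open>space M\<close>, hence
      \<open>0 < k\<close>.\<close>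
    have "prob ?C \<le> (1 - p) ^ k" if "0 < k" for k
    proof -
      have "prob ?C \<le> prob (\<Inter>i\<in>{n..<n+k}. Z i -` ?B \<inter> space M)"
        using that evB by (intro finite_measure_mono sets.finite_INT) auto
      also have "\<dots> = (\<Prod>i\<in>{n..<n+k}. prob (Z i -` ?B \<inter> space M))"
        using that A by (intro indep_varsD[OF indep]) auto
      finally show ?thesis by (simp add: probB)
    qed
    moreover have "(\<lambda>k. (1 - p) ^ k) \<longlonglongrightarrow> 0"
      using p p1 by (intro LIMSEQ_power_zero) simp
    ultimately have "prob ?C \<le> 0"
      by (intro LIMSEQ_le_const) (auto intro!: exI[of _ 1])
    then have "prob ?C = 0" by (meson measure_nonneg order_antisym)
    then have "AE \<omega> in M. \<omega> \<notin> ?C" using prob_eq_0[OF ev] by simp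
    then show ?thesis using AE_space by eventually_elim auto
  qed
  then have "AE \<omega> in M. \<forall>n. \<not> (\<forall>i\<ge>n. Z i \<omega> \<in> ?B)" by (simp add: AE_all_countable)
  then show ?thesis
    using AE_space
  proof eventually_elim
    case (elim \<omega>)
    then show ?case
      using measurable_space[OF rv] by (auto simp: infinite_nat_iff_unbounded_le)
  qed
qed

text \<open>Outside a neighbourhood of \<open>l\<close>, finitely many of the avoided open sets
  cover the rest of \<open>K\<close>, and finitely many eventual statements hold together.\<close>

lemma tendsto_compact_avoid:
  fixes l :: "'a::t2_space"
  assumes K: "compact K" and q: "eventually (\<lambda>n. q n \<in> K) F"
    and avoid: "\<And>p. p \<in> K \<Longrightarrow> p \<noteq> l \<Longrightarrow> \<exists>B. open B \<and> p \<in> B \<and> eventually (\<lambda>n. q n \<notin> B) F"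
  shows "(q \<longlongrightarrow> l) F"
proof (rule topological_tendstoI)
  fix V assume V: "open V" "l \<in> V"
  have "\<forall>p\<in>K - V. \<exists>B. open B \<and> p \<in> B \<and> eventually (\<lambda>n. q n \<notin> B) F"
    using avoid V by blast
  then obtain B where B: "\<And>p. p \<in> K - V \<Longrightarrow> open (B p) \<and> p \<in> B p \<and> eventually (\<lambda>n. q n \<notin> B p) F"
    by metis
  have "compact (K - V)" using K V by (simp add: compact_diff)
  then obtain T where T: "T \<subseteq> K - V" "finite T" "K - V \<subseteq> (\<Union>p\<in>T. B p)"
    using B by (elim compactE_image[of _ "K - V" B]) auto
  have "eventually (\<lambda>n. \<forall>p\<in>T. q n \<notin> B p) F"
    using T B by (intro eventually_ball_finite) auto
  with q show "eventually (\<lambda>n. q n \<in> V) F"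
    by eventually_elim (use T in blast)
qed

text \<open>The indices in \<open>I\<close> and the bound \<delta> do not depend on
  \<open>p\<close>, so enough of these indices lie below one \<open>n0\<close> that works for all
  \<open>p\<close> in \<open>B\<close> at once.\<close>

lemma sum_exceeds_if_infinitely_often:
  fixes a :: "'b \<Rightarrow> nat \<Rightarrow> real"
  assumes "infinite I" "0 < \<delta>"
    and low: "\<And>i p. i \<in> I \<Longrightarrow> p \<in> B \<Longrightarrow> \<delta> \<le> a p i"
    and nonneg: "\<And>i p. p \<in> B \<Longrightarrow> 0 \<le> a p i"
  shows "eventually (\<lambda>n. \<forall>p\<in>B. c < (\<Sum>i<n. a p i)) sequentially"
proof -
  obtain m where m: "c < real m * \<delta>" using reals_Archimedean3[OF \<open>0 < \<delta>\<close>] by blast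
  obtain J where J: "J \<subseteq> I" "finite J" "card J = m"
    using infinite_arbitrarily_large[OF \<open>infinite I\<close>] by metis
  obtain n0 where n0: "J \<subseteq> {..<n0}" using J(2) finite_nat_iff_bounded by blast
  show ?thesis
    unfolding eventually_sequentially
  proof (intro exI allI impI ballI)
    fix n p assume n: "n0 \<le> n" and p: "p \<in> B"
    have "c < real (card J) * \<delta>" using m J by simp
    also have "\<dots> \<le> (\<Sum>i\<in>J. a p i)" using low p J by (intro sum_bounded_below) auto
    also have "\<dots> \<le> (\<Sum>i<n. a p i)" using n n0 nonneg p by (intro sum_mono2) auto
    finally show "c < (\<Sum>i<n. a p i)" .
  qed
qed

section \<open>Strong consistency of the estimator\<close>

theorem theorem6:
  fixes M :: "'a measure"
    and f g :: "real ^ 'p \<Rightarrow> real ^ 'd \<Rightarrow> real ^ 'p \<Rightarrow> real"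
    and D :: "(real ^ 'd) set" and W \<Theta> :: "(real ^ 'p) set" and E :: "real set"
    and U :: "nat \<Rightarrow> 'a \<Rightarrow> real ^ 'd"
    and X N Y :: "nat \<Rightarrow> 'a \<Rightarrow> real ^ 'p"
    and fW :: "real ^ 'p \<Rightarrow> ennreal" and fX :: "(real ^ 'd) \<times> (real ^ 'p) \<Rightarrow> ennreal"
    and \<epsilon>0 :: real and \<theta>0 :: "real ^ 'p"
    and lam z :: "nat \<Rightarrow> real"
    and breve hat :: "nat \<Rightarrow> 'a \<Rightarrow> real \<times> (real ^ 'p)"
  assumes "prob_space M"
    and "continuous_on (UNIV \<times> D \<times> \<Theta>) (\<lambda>(x, u, \<theta>). f x u \<theta>)"
    and "continuous_on (UNIV \<times> D \<times> \<Theta>) (\<lambda>(x, u, \<theta>). g x u \<theta>)"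
    and "\<And>u \<theta>. u \<in> D \<Longrightarrow> \<theta> \<in> \<Theta> \<Longrightarrow> convex_on UNIV (\<lambda>x. f x u \<theta>)"
    and "\<And>u \<theta>. u \<in> D \<Longrightarrow> \<theta> \<in> \<Theta> \<Longrightarrow> convex_on UNIV (\<lambda>x. g x u \<theta>)"
    and "\<And>u \<theta>. u \<in> D \<Longrightarrow> \<theta> \<in> \<Theta> \<Longrightarrow> \<exists>x. g x u \<theta> < 0"
    and min_attained: "\<And>u \<theta>. u \<in> D \<Longrightarrow> \<theta> \<in> \<Theta> \<Longrightarrow>
           \<exists>x. is_arg_min (\<lambda>x. f x u \<theta>) (\<lambda>x. g x u \<theta> \<le> 0) x"
    and "E \<subseteq> {0..}" and "closed E" and "\<epsilon>0 \<in> E"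
    and "compact \<Theta>" and "\<theta>0 \<in> \<Theta>"
    and "convex W" and "bounded W"
    and "iid M borel (\<lambda>i \<omega>. (U i \<omega>, X i \<omega>, N i \<omega>))"
    and "\<And>i. AE \<omega> in M. U i \<omega> \<in> D"
    and "\<And>i. AE \<omega> in M. X i \<omega> \<in> sol_set f g (U i \<omega>) \<epsilon>0 \<theta>0"
    and "\<And>i. AE \<omega> in M. N i \<omega> \<in> W"
    and "\<And>i. prob_space.expectation M (N i) = 0"
    and "\<And>i \<omega>. Y i \<omega> = X i \<omega> + N i \<omega>"
    and "\<And>i. distributed M lborel (N i) fW"
    and "\<And>w. w \<in> interior W \<Longrightarrow> fW w > 0"
    and "\<And>i. has_cond_density M (U i) (X i) fX"
    and "\<And>i. AE \<omega> in M. \<forall>x \<in> interior (sol_set f g (U i \<omega>) \<epsilon>0 \<theta>0). fX (U i \<omega>, x) > 0"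
    and "identifiable M f g W U Y \<Theta> \<epsilon>0 \<theta>0"
    and "\<And>n. n \<ge> 1 \<Longrightarrow> lam n = 1 / real n"
    and "\<And>n. n \<ge> 1 \<Longrightarrow> z n \<ge> 0"
    and "(\<lambda>n. real n * z n) \<longlonglongrightarrow> 0"
    and "\<And>n. n \<ge> 1 \<Longrightarrow> AE \<omega> in M.
           is_arg_min (abp_obj f g W n (lam n) (\<lambda>i. U i \<omega>) (\<lambda>i. Y i \<omega>)) (\<lambda>p. p \<in> E \<times> \<Theta>) (breve n \<omega>)"
    and "\<And>n. n \<ge> 1 \<Longrightarrow> AE \<omega> in M. hat n \<omega> \<in> {p \<in> E \<times> \<Theta>.
           abp_obj f g W n (lam n) (\<lambda>i. U i \<omega>) (\<lambda>i. Y i \<omega>) p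
             \<le> abp_obj f g W n (lam n) (\<lambda>i. U i \<omega>) (\<lambda>i. Y i \<omega>) (breve n \<omega>) + z n}"
  shows "AE \<omega> in M. (\<lambda>n. hat n \<omega>) \<longlonglongrightarrow> (\<epsilon>0, \<theta>0)"
proof -
  interpret prob_space M by fact
  interpret convex_program f g D \<Theta> by unfold_locales (fact assms)+
  let ?l = "(\<epsilon>0, \<theta>0)"
  let ?S = "\<lambda>i \<omega> p. sol_set f g (U i \<omega>) (fst p) (snd p) + W"
  have \<epsilon>0: "0 \<le> \<epsilon>0" using \<open>E \<subseteq> {0..}\<close> \<open>\<epsilon>0 \<in> E\<close> by auto
  have Y: "Y i = (\<lambda>\<omega>. X i \<omega> + N i \<omega>)" for i
    using \<open>\<And>i \<omega>. Y i \<omega> = X i \<omega> + N i \<omega>\<close> by auto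
  have W_ne: "W \<noteq> {}"
  proof
    assume "W = {}"
    with \<open>\<And>i. AE \<omega> in M. N i \<omega> \<in> W\<close> show False by simp
  qed

  \<comment> \<open>Independence and equal distribution are given for the triples; \<phi> maps a
    triple to the observed pair, so events about the data are preimages under \<phi>.\<close>
  define Z where "Z i \<omega> = (U i \<omega>, X i \<omega>, N i \<omega>)" for i \<omega>
  define \<phi> :: "(real ^ 'd) \<times> (real ^ 'p) \<times> (real ^ 'p) \<Rightarrow> (real ^ 'd) \<times> (real ^ 'p)"
    where "\<phi> = (\<lambda>t. (fst t, fst (snd t) + snd (snd t)))"
  have \<phi>_meas: "\<phi> \<in> borel_measurable borel"
    unfolding \<phi>_def by (intro borel_measurable_continuous_onI continuous_intros)
  have \<phi>_Z: "\<phi> (Z i \<omega>) = (U i \<omega>, Y i \<omega>)" for i \<omega> by (simp add: \<phi>_def Z_def Y)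
  have iid: "indep_vars (\<lambda>_. borel) Z UNIV" "\<And>i. distr M borel (Z i) = distr M borel (Z 0)"
    using \<open>iid M borel _\<close> unfolding iid_def Z_def[abs_def] by blast+
  have Z_meas: "Z i \<in> borel_measurable M" for i
    using iid(1) unfolding indep_vars_def by auto
  have UY_meas: "U i \<in> borel_measurable M" "Y i \<in> borel_measurable M" for i
  proof -
    have "(\<lambda>\<omega>. fst (\<phi> (Z i \<omega>))) \<in> borel_measurable M" "(\<lambda>\<omega>. snd (\<phi> (Z i \<omega>))) \<in> borel_measurable M"
      by (auto intro!: measurable_compose[OF measurable_compose[OF Z_meas \<phi>_meas]]
          borel_measurable_continuous_onI continuous_intros)
    then show "U i \<in> borel_measurable M" "Y i \<in> borel_measurable M" by (simp_all add: \<phi>_Z)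
  qed

  have recurrent: "AE \<omega> in M. infinite {i. (U i \<omega>, Y i \<omega>) \<in> G}"
    if "open G" "0 < prob {\<omega> \<in> space M. (U 0 \<omega>, Y 0 \<omega>) \<in> G}" for G
  proof -
    have A: "\<phi> -` G \<in> sets borel"
      using measurable_sets[OF \<phi>_meas borel_open[OF that(1)]] by simp
    \<comment> \<open>Equal distribution carries the positive probability from index 0 to all
      indices.\<close>
    have "prob (Z i -` (\<phi> -` G) \<inter> space M) = prob (Z 0 -` (\<phi> -` G) \<inter> space M)" for i
      using arg_cong[OF iid(2)[of i], of "\<lambda>Q. measure Q (\<phi> -` G)"] A Z_meas
      by (simp add: measure_distr)
    moreover have "Z 0 -` (\<phi> -` G) \<inter> space M = {\<omega> \<in> space M. (U 0 \<omega>, Y 0 \<omega>) \<in> G}"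
      unfolding \<phi>_Z[symmetric] by blast
    then have "0 < prob (Z 0 -` (\<phi> -` G) \<inter> space M)" using that(2) by (simp only:)
    ultimately have "AE \<omega> in M. infinite {i. Z i \<omega> \<in> \<phi> -` G}"
      by (rule indep_vars_infinitely_often[OF iid(1) A])
    then show ?thesis by (simp add: \<phi>_Z)
  qed

  \<comment> \<open>The wrong parameters not yet excluded by the penalty, which rules out
    \<open>\<epsilon> > \<epsilon>0\<close> on its own.\<close>
  let ?K = "({0..\<epsilon>0} \<times> \<Theta>) - {?l}"
  define sep where "sep p G \<delta> \<longleftrightarrow> 0 < \<delta> \<and> (AE \<omega> in M. infinite {i. (U i \<omega>, Y i \<omega>) \<in> G}) \<and>
      (\<forall>u y q. (u, y) \<in> G \<longrightarrow> u \<in> D \<longrightarrow> q \<in> ball p \<delta> \<longrightarrow> 0 \<le> fst q \<longrightarrow> snd q \<in> \<Theta> \<longrightarrow>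
         \<delta> \<le> dist_sq y (sol_set f g u (fst q) (snd q) + W))" for p G \<delta>
  have "\<exists>G \<delta>. sep p G \<delta>" if "p \<in> ?K" for p
  proof -
    obtain \<epsilon> \<theta> where p: "p = (\<epsilon>, \<theta>)" by force
    with that have "\<epsilon> \<in> {0..\<epsilon>0}" "\<theta> \<in> \<Theta>" "\<epsilon> < \<epsilon>0 \<or> \<theta> \<noteq> \<theta>0" by auto
    then have pos: "0 < (\<integral>\<^sup>+ \<omega>. ennreal (dist_sq (Y 0 \<omega>) (sol_set f g (U 0 \<omega>) \<epsilon> \<theta> + W)) \<partial>M)"
      using \<open>identifiable M f g W U Y \<Theta> \<epsilon>0 \<theta>0\<close> unfolding identifiable_def by blast
    obtain G \<delta> where G: "open G" "0 < prob {\<omega> \<in> space M. (U 0 \<omega>, Y 0 \<omega>) \<in> G}" and "0 < \<delta>"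
      and "\<And>u y \<epsilon>' \<theta>'. (u, y) \<in> G \<Longrightarrow> u \<in> D \<Longrightarrow> (\<epsilon>', \<theta>') \<in> ball (\<epsilon>, \<theta>) \<delta> \<Longrightarrow> 0 \<le> \<epsilon>' \<Longrightarrow> \<theta>' \<in> \<Theta> \<Longrightarrow>
         \<delta> \<le> dist_sq y (sol_set f g u \<epsilon>' \<theta>' + W)"
      by (rule positive_loss_neighbourhood[OF \<open>prob_space M\<close> UY_meas \<open>\<And>i. AE \<omega> in M. U i \<omega> \<in> D\<close>
          \<open>bounded W\<close> W_ne \<open>\<theta> \<in> \<Theta>\<close> pos]) blast
    then show ?thesis unfolding sep_def using recurrent[OF G] p
      by (intro exI[of _ G] exI[of _ \<delta>]) auto
  qed
  then obtain G \<delta> where sep: "\<And>p. p \<in> ?K \<Longrightarrow> sep p (G p) (\<delta> p)" by metis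
  have \<delta>: "0 < \<delta> p" and rec: "AE \<omega> in M. infinite {i. (U i \<omega>, Y i \<omega>) \<in> G p}" if "p \<in> ?K" for p
    using sep[OF that] unfolding sep_def by blast+
  have low: "\<delta> p \<le> dist_sq y (sol_set f g u (fst q) (snd q) + W)"
    if "p \<in> ?K" "(u, y) \<in> G p" "u \<in> D" "q \<in> ball p (\<delta> p)" "0 \<le> fst q" "snd q \<in> \<Theta>" for p u y q
    using sep[OF that(1)] that(2-) unfolding sep_def by blast
  \<comment> \<open>The null set on which recurrence fails depends on the centre \<open>p\<close>.
    Lindelof's theorem leaves countably many balls with the same union, so that these null sets can
    be discarded together.\<close>
  define \<F> where "\<F> = (\<lambda>p. ball p (\<delta> p)) ` ?K"
  have "open S" if "S \<in> \<F>" for S using that by (auto simp: \<F>_def)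
  then obtain \<B> where \<B>: "\<B> \<subseteq> \<F>" "countable \<B>" "\<Union>\<B> = \<Union>\<F>"
    using Lindelof[of \<F>] by metis
  then obtain P where P: "countable P" "P \<subseteq> ?K" "\<B> = (\<lambda>p. ball p (\<delta> p)) ` P"
    using countable_subset_image[of \<B> "\<lambda>p. ball p (\<delta> p)" ?K] unfolding \<F>_def by blast

  \<comment> \<open>All almost sure facts are gathered over countable index sets; afterwards
    \<omega> is fixed and the argument is deterministic.\<close>
  have "AE \<omega> in M. \<forall>p\<in>P. infinite {i. (U i \<omega>, Y i \<omega>) \<in> G p}"
    using P rec by (subst AE_ball_countable) auto
  moreover have "AE \<omega> in M. \<forall>i. U i \<omega> \<in> D \<and> X i \<omega> \<in> sol_set f g (U i \<omega>) \<epsilon>0 \<theta>0 \<and> N i \<omega> \<in> W"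
    unfolding AE_all_countable AE_conj_iff using assms by blast
  moreover have "AE \<omega> in M. \<forall>n\<in>{1..}.
      is_arg_min (abp_obj f g W n (lam n) (\<lambda>i. U i \<omega>) (\<lambda>i. Y i \<omega>)) (\<lambda>p. p \<in> E \<times> \<Theta>) (breve n \<omega>)"
    using assms by (subst AE_ball_countable) auto
  moreover have "AE \<omega> in M. \<forall>n\<in>{1..}. hat n \<omega> \<in> {p \<in> E \<times> \<Theta>.
      abp_obj f g W n (lam n) (\<lambda>i. U i \<omega>) (\<lambda>i. Y i \<omega>) p
        \<le> abp_obj f g W n (lam n) (\<lambda>i. U i \<omega>) (\<lambda>i. Y i \<omega>) (breve n \<omega>) + z n}"
    by (subst AE_ball_countable) (use assms in \<open>auto\<close>)
  ultimately show ?thesis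
  proof eventually_elim
    case (elim \<omega>)
    let ?d = "\<lambda>q i. dist_sq (Y i \<omega>) (?S i \<omega> q)"
    have UD: "U i \<omega> \<in> D" for i using elim by blast
    have d_nonneg: "0 \<le> ?d q i" if "q \<in> {0..} \<times> \<Theta>" for q i
      using that by (intro dist_sq_nonneg set_plus_nonempty sol_set_nonempty UD W_ne) auto
    \<comment> \<open>The noise-free part of each observation lies in the true solution set and the
      noise in \<open>W\<close>.\<close>
    have d_true: "?d ?l i = 0" for i
      using elim by (intro dist_sq_eq_0) (auto simp: Y intro!: set_plus_intro)
    have hat_mem: "hat n \<omega> \<in> E \<times> \<Theta>" if "1 \<le> n" for n using elim that by auto
    then have hat_nonneg: "hat n \<omega> \<in> {0..} \<times> \<Theta>" if "1 \<le> n" for n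
      using hat_mem[OF that] \<open>E \<subseteq> {0..}\<close> unfolding mem_Times_iff by blast
    have bound: "(\<Sum>i<n. ?d (hat n \<omega>) i) + fst (hat n \<omega>) \<le> \<epsilon>0 + real n * z n" if n: "1 \<le> n" for n
    proof -
      let ?obj = "abp_obj f g W n (lam n) (\<lambda>i. U i \<omega>) (\<lambda>i. Y i \<omega>)"
      \<comment> \<open>Since \<open>lam n = 1 / real n\<close>, multiplying by \<open>n\<close>
        leaves the full loss sum and turns the penalty into \<epsilon> itself, a bounded quantity at
        the truth.\<close>
      have obj: "real n * ?obj q = (\<Sum>i<n. ?d q i) + fst q" for q
        using n \<open>\<And>n. n \<ge> 1 \<Longrightarrow> lam n = 1 / real n\<close>[OF n] by (cases q) (simp add: abp_obj_def distrib_left)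
      have "?obj (hat n \<omega>) \<le> ?obj (breve n \<omega>) + z n" using elim n by auto
      also have "?obj (breve n \<omega>) \<le> ?obj ?l"
        using elim n \<open>\<epsilon>0 \<in> E\<close> \<open>\<theta>0 \<in> \<Theta>\<close> by (auto simp: is_arg_min_linorder)
      finally have "real n * ?obj (hat n \<omega>) \<le> real n * (?obj ?l + z n)"
        by (intro mult_left_mono) auto
      then show ?thesis using d_true by (simp add: obj distrib_left)
    qed
    have fst_le: "fst (hat n \<omega>) \<le> \<epsilon>0 + real n * z n" if "1 \<le> n" for n
    proof -
      have "0 \<le> (\<Sum>i<n. ?d (hat n \<omega>) i)" by (intro sum_nonneg d_nonneg hat_nonneg that)
      with bound[OF that] show ?thesis by linarith
    qed
    have ev1: "eventually (\<lambda>n. 1 \<le> n) sequentially" by (rule eventually_ge_at_top)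
    have nz: "eventually (\<lambda>n. real n * z n < e) sequentially" if "0 < e" for e
      using \<open>(\<lambda>n. real n * z n) \<longlonglongrightarrow> 0\<close> that by (rule order_tendstoD(2))
    show "(\<lambda>n. hat n \<omega>) \<longlonglongrightarrow> ?l"
    proof (rule tendsto_compact_avoid)
      \<comment> \<open>The slack 1 absorbs \<open>real n * z n\<close>, which is eventually below
        1.\<close>
      show "compact ({0..\<epsilon>0 + 1} \<times> \<Theta>)" using \<open>compact \<Theta>\<close> by (intro compact_Times) auto
      show "eventually (\<lambda>n. hat n \<omega> \<in> {0..\<epsilon>0 + 1} \<times> \<Theta>) sequentially"
        using ev1 nz[of 1, simplified]
      proof eventually_elim
        case (elim n)
        then show ?case using hat_nonneg[of n] fst_le[of n] by (auto simp: mem_Times_iff)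
      qed
    next
      fix p assume p: "p \<in> {0..\<epsilon>0 + 1} \<times> \<Theta>" "p \<noteq> ?l"
      show "\<exists>B. open B \<and> p \<in> B \<and> eventually (\<lambda>n. hat n \<omega> \<notin> B) sequentially"
      proof (cases "fst p \<le> \<epsilon>0")
        case False
        \<comment> \<open>Half the gap: once \<open>real n * z n < e\<close>, the estimate stays at
          or below \<open>\<epsilon>0 + e\<close>, strictly short of \<open>fst p\<close>.\<close>
        define e where "e = (fst p - \<epsilon>0) / 2"
        have e: "0 < e" "\<epsilon>0 + e < fst p" using False by (auto simp: e_def field_simps)
        have "eventually (\<lambda>n. hat n \<omega> \<notin> {\<epsilon>0 + e<..} \<times> UNIV) sequentially"
          using ev1 nz[OF e(1)]
        proof eventually_elim
          case (elim n)
          then show ?case using fst_le[of n] by (auto simp: mem_Times_iff)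
        qed
        with e show ?thesis
          by (intro exI[of _ "{\<epsilon>0 + e<..} \<times> UNIV"]) (auto simp: mem_Times_iff intro!: open_Times)
      next
        case True
        with p have "p \<in> ?K" by (auto simp: mem_Times_iff)
        then have "p \<in> \<Union>\<B>" using \<B>(3) \<delta>[of p] centre_in_ball unfolding \<F>_def by blast
        then obtain p' where p': "p' \<in> P" "p \<in> ball p' (\<delta> p')" using P by auto
        then have p'K: "p' \<in> ?K" using P by auto
        \<comment> \<open>The loss of the estimate is at most
          \<open>\<epsilon>0 + real n * z n\<close>, eventually below
          \<open>\<epsilon>0 + 1\<close>, so exceeding this threshold throughout the ball expels the
          estimate. The ball is cut down to admissible parameters, where the solution sets are
          nonempty.\<close>
        have "eventually (\<lambda>n. \<forall>q\<in>ball p' (\<delta> p') \<inter> {0..} \<times> \<Theta>. \<epsilon>0 + 1 < (\<Sum>i<n. ?d q i)) sequentially"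
        proof (rule sum_exceeds_if_infinitely_often)
          show "infinite {i. (U i \<omega>, Y i \<omega>) \<in> G p'}" using elim p' by blast
          show "0 < \<delta> p'" using \<delta> p'K .
          show "\<delta> p' \<le> ?d q i" if "i \<in> {i. (U i \<omega>, Y i \<omega>) \<in> G p'}" "q \<in> ball p' (\<delta> p') \<inter> {0..} \<times> \<Theta>" for i q
            using low[OF p'K, of "U i \<omega>" "Y i \<omega>" q] that UD by (auto simp: mem_Times_iff)
          show "0 \<le> ?d q i" if "q \<in> ball p' (\<delta> p') \<inter> {0..} \<times> \<Theta>" for i q
            using d_nonneg that by blast
        qed
        then have "eventually (\<lambda>n. hat n \<omega> \<notin> ball p' (\<delta> p')) sequentially"
          using ev1 nz[of 1, simplified]
        proof eventually_elim
          case (elim n)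
          have "0 \<le> fst (hat n \<omega>)" using hat_nonneg[OF elim(2)] by (auto simp: mem_Times_iff)
          then have "(\<Sum>i<n. ?d (hat n \<omega>) i) < \<epsilon>0 + 1" using bound[OF elim(2)] elim(3) by linarith
          then show ?case using bspec[OF elim(1) IntI[OF _ hat_nonneg[OF elim(2)]]] less_asym by blast
        qed
        with p' show ?thesis by (intro exI[of _ "ball p' (\<delta> p')"]) auto
      qed
    qed
  qed
qed

end
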